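(* Let $\mathcal C$ be a class of graphs and $m,\Delta,k:\mathbb N\to\mathbb N$ functions such that every $n$-vertex graph $G\in\mathcal C$ admits a merge sequence of length at most $m(n)$, valency at most $\Delta(n)$, and radius-$1$ width at most $k(n)$. Then $\mathcal C$ admits a labelling scheme of length $O(m(n)\cdot k(n)\cdot\log\Delta(n))$.
   Context: Graphs are finite, simple, undirected. For a partition $\mathcal P$ of $V(G)$ and $X\subseteq V(G)$, $X/\mathcal P$ is the set of parts intersecting $X$. For $R\subseteq\binom{V(G)}2$, $\mathrm{Ball}^r_R(v)$ is the radius-$r$ ball in $(V(G),R)$. $\mathcal P$ is homogeneous modulo $R$ if for all parts $X,Y$ (possibly equal), the pairs $\{x,y\}$, $x\in X,y\in Y,x\ne y$, not in $R$ are all edges of $G$ or all non-edges. A merge sequence for $G$ is $(\mathcal P_1,R_1),\dots,(\mathcal P_m,R_m)$ with $\mathcal P_1\preceq\dots\preceq\mathcal P_m$ partitions of $V(G)$, $\mathcal P_1$ into singletons, $\mathcal P_m=\{V(G)\}$, $R_1\subseteq\dots\subseteq R_m$, $\mathcal P_t$ homogeneous modulo $R_t$; its length is $m$; its radius-$r$ width is $\max_{t<m}\max_v|\mathrm{Ball}^r_{R_{t+1}}(v)/\mathcal P_t|$; its valency is the least $\Delta$ such that for every $i\in[m-1]$ every part of $\mathcal P_{i+1}$ is a union of at most $\Delta$ parts of $\mathcal P_i$. A labelling scheme for $\mathcal C$ is a pair of functions: an encoder assigning to each $G\in\mathcal C$ and $u\in V(G)$ a binary word $\mathcal E_G(u)$,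 and a decoder mapping pairs of binary words to accept/reject, such that for all $G\in\mathcal C$ and distinct $u,v\in V(G)$, $uv\in E(G)$ iff the decoder accepts $(\mathcal E_G(u),\mathcal E_G(v))$. Its length is $\ell(n)=\max\{|\mathcal E_G(u)|:G\in\mathcal C,|V(G)|=n,u\in V(G)\}$; no computability is required. *)

theory Defs
  imports Complex_Main "HOL-Library.Disjoint_Sets" "HOL-Library.Ramsey"
    "HOL-Library.Landau_Symbols"
begin

type_synonym 'a ugraph = "'a set \<times> 'a set set"

abbreviation verts :: "'a ugraph \<Rightarrow> 'a set" where
  "verts G \<equiv> fst G"

abbreviation edges :: "'a ugraph \<Rightarrow> 'a set set" where
  "edges G \<equiv> snd G"

definition simple_graph :: "'a ugraph \<Rightarrow> bool" where
  "simple_graph G \<longleftrightarrow> finite (verts G) \<and> edges G \<subseteq> [verts G]\<^bsup>2\<^esup>"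

definition parts_meeting :: "'a set \<Rightarrow> 'a set set \<Rightarrow> 'a set set" where
  "parts_meeting X P = {Y \<in> P. Y \<inter> X \<noteq> {}}"

definition Ball_R :: "'a set set \<Rightarrow> nat \<Rightarrow> 'a \<Rightarrow> 'a set" where
  "Ball_R R r v = {w. \<exists>d\<le>r. (v, w) \<in> {(x, y). {x, y} \<in> R} ^^ d}"

definition homogeneous_mod :: "'a ugraph \<Rightarrow> 'a set set \<Rightarrow> 'a set set \<Rightarrow> bool" where
  "homogeneous_mod G R P \<longleftrightarrow>
     (\<forall>X\<in>P. \<forall>Y\<in>P.
        (\<forall>x\<in>X. \<forall>y\<in>Y. x \<noteq> y \<and> {x, y} \<notin> R \<longrightarrow> {x, y} \<in> edges G) \<or>
        (\<forall>x\<in>X. \<forall>y\<in>Y. x \<noteq> y \<and> {x, y} \<notin> R \<longrightarrow> {x, y} \<notin> edges G))"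

text \<open>The pair (P_t, R_t), with t counted from 1, is the list element at position t - 1.\<close>

type_synonym 'a mseq = "('a set set \<times> 'a set set) list"

definition merge_sequence :: "'a ugraph \<Rightarrow> 'a mseq \<Rightarrow> bool" where
  "merge_sequence G S \<longleftrightarrow>
     S \<noteq> [] \<and>
     (\<forall>(P, R) \<in> set S.
        partition_on (verts G) P \<and> R \<subseteq> [verts G]\<^bsup>2\<^esup> \<and> homogeneous_mod G R P) \<and>
     fst (hd S) = (\<lambda>v. {v}) ` verts G \<and>
     fst (last S) = {verts G} \<and>
     (\<forall>i. Suc i < length S \<longrightarrow>
        refines (verts G) (fst (S ! i)) (fst (S ! Suc i)) \<and>
        snd (S ! i) \<subseteq> snd (S ! Suc i))"

text \<open>A sequence of length 1 has width 0, the maximum of the empty set.\<close>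

definition radius_width :: "nat \<Rightarrow> 'a ugraph \<Rightarrow> 'a mseq \<Rightarrow> nat" where
  "radius_width r G S =
     Max (insert 0 {card (parts_meeting (Ball_R (snd (S ! Suc i)) r v) (fst (S ! i))) | i v.
       Suc i < length S \<and> v \<in> verts G})"

definition valency :: "'a mseq \<Rightarrow> nat" where
  "valency S =
     (LEAST d. \<forall>i. Suc i < length S \<longrightarrow>
        (\<forall>Y \<in> fst (S ! Suc i).
           \<exists>F \<subseteq> fst (S ! i). finite F \<and> card F \<le> d \<and> Y = \<Union>F))"

type_synonym 'a encoder = "'a ugraph \<Rightarrow> 'a \<Rightarrow> bool list"
type_synonym decoder = "bool list \<Rightarrow> bool list \<Rightarrow> bool"

definition labelling_scheme :: "'a ugraph set \<Rightarrow> 'a encoder \<Rightarrow> decoder \<Rightarrow> bool" where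
  "labelling_scheme C enc dec \<longleftrightarrow>
     (\<forall>G\<in>C. \<forall>u\<in>verts G. \<forall>v\<in>verts G. u \<noteq> v \<longrightarrow>
        ({u, v} \<in> edges G \<longleftrightarrow> dec (enc G u) (enc G v)))"

definition label_lengths :: "'a ugraph set \<Rightarrow> 'a encoder \<Rightarrow> nat \<Rightarrow> nat set" where
  "label_lengths C enc n = {length (enc G u) | G u. G \<in> C \<and> card (verts G) = n \<and> u \<in> verts G}"

text \<open>A class may contain infinitely many graphs on n vertices (isomorphic copies), so finiteness
  is demanded for the maximum to exist. If there are no labels to consider, the length is 0.\<close>

definition has_scheme_length :: "'a ugraph set \<Rightarrow> 'a encoder \<Rightarrow> (nat \<Rightarrow> nat) \<Rightarrow> bool" where
  "has_scheme_length C enc l \<longleftrightarrow>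
     (\<forall>n. finite (label_lengths C enc n) \<and> l n = Max (insert 0 (label_lengths C enc n)))"

end

theory Submission
  imports Defs
begin

text \<open>The parts of all levels of a merge sequence form a tree; a part is named by the list of child
  indices, each of O(log \<Delta>) bits, on the way up to the root. The parts of level t that meet the
  radius-1 ball of u in R (t + 1) are at most k, and since R grows with t they are closed under
  parents. So the parts near u form a subtree with at most m k nodes, which a depth-first traversal
  describes with O(m k log \<Delta>) bits; naming each node separately would cost a further factor m.
  The label of u is this subtree, with one adjacency bit per node, together with the name of u.
  To decide adjacency of u and v, look up the lowest part containing v that is near u.\<close>

section \<open>Binary words for sequences of numbers\<close>

text \<open>Each binary digit, lowest first, follows a flag \<open>True\<close>, and
  \<open>False\<close> ends the word. This makes the code self-delimiting at two bits per
  digit.\<close>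

fun nat_code :: "nat \<Rightarrow> bool list" where
  "nat_code n = (if n = 0 then [False] else True # odd n # nat_code (n div 2))"

declare nat_code.simps [simp del]

text \<open>The first bit tells whether the number is 0; if not, the second gives its parity and the
  rest encodes its half. The arbitrary tails \<open>r\<close> and \<open>s\<close> allow
  concatenated codes to be split.\<close>

lemma nat_code_prefix_free:
  "nat_code a @ r = nat_code b @ s \<Longrightarrow> a = b \<and> r = s"
proof (induction a arbitrary: b rule: nat_code.induct)
  case (1 a)
  show ?case
  proof (cases "a = 0 \<or> b = 0")
    case True
    then show ?thesis
      using "1.prems" nat_code.simps[of a] nat_code.simps[of b] by (auto split: if_splits)
  next
    case False
    then have eq: "odd a = odd b" "nat_code (a div 2) @ r = nat_code (b div 2) @ s"
      using "1.prems" nat_code.simps[of a] nat_code.simps[of b] by auto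
    then have "a div 2 = b div 2 \<and> r = s"
      using "1.IH" False by blast
    moreover have "a mod 2 = b mod 2"
      using eq(1) by presburger
    ultimately show ?thesis
      by (metis div_mult_mod_eq)
  qed
qed

lemma length_nat_code: "n < 2 ^ j \<Longrightarrow> length (nat_code n) \<le> 2 * j + 1"
proof (induction j arbitrary: n)
  case 0
  then show ?case by (simp add: nat_code.simps)
next
  case (Suc j)
  then have "n div 2 < 2 ^ j" by auto
  from Suc.IH[OF this] show ?case by (subst nat_code.simps) auto
qed

definition word_code :: "nat list \<Rightarrow> bool list" where
  "word_code xs = concat (map nat_code xs)"

lemma nat_code_nonempty: "nat_code n \<noteq> []"
  by (subst nat_code.simps) auto

text \<open>Prefix-freeness strips one number at a time from both words; since codes are nonempty,
  neither list can end early.\<close>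

lemma inj_word_code: "inj word_code"
proof
  fix xs ys assume "word_code xs = word_code ys"
  then show "xs = ys"
  proof (induction xs arbitrary: ys)
    case Nil
    then show ?case by (cases ys) (auto simp: word_code_def nat_code_nonempty)
  next
    case (Cons x xs)
    show ?case
    proof (cases ys)
      case Nil
      then show ?thesis using Cons.prems by (auto simp: word_code_def nat_code_nonempty)
    next
      case (Cons y ys')
      then have "nat_code x @ word_code xs = nat_code y @ word_code ys'"
        using Cons.prems by (simp add: word_code_def)
      then show ?thesis
        using nat_code_prefix_free Cons.IH Cons by blast
    qed
  qed
qed

lemma length_word_code:
  assumes "\<And>x. x \<in> set xs \<Longrightarrow> x < 2 ^ j"
  shows "length (word_code xs) \<le> length xs * (2 * j + 1)"
  using assms
proof (induction xs)
  case (Cons x xs)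
  then have "length (nat_code x) \<le> 2 * j + 1" "length (word_code xs) \<le> length xs * (2 * j + 1)"
    using length_nat_code by (metis list.set_intros)+
  then show ?case by (simp add: word_code_def)
qed (simp add: word_code_def)

section \<open>Walks describing rooted trees\<close>

text \<open>A node of a tree is the list of child indices on the way up to the root, so that the stack
  of a depth-first traversal is the current node: Some pushes a child together with its bit,
  None pops.\<close>

type_synonym token = "(nat \<times> bool) option"

fun walk :: "token list \<Rightarrow> nat list \<Rightarrow> (nat list \<times> bool) set" where
  "walk [] s = {}"
| "walk (Some (i, b) # ws) s = insert (i # s, b) (walk ws (i # s))"
| "walk (None # ws) s = walk ws (tl s)"

fun walk_end :: "token list \<Rightarrow> nat list \<Rightarrow> nat list" where
  "walk_end [] s = s"
| "walk_end (Some (i, b) # ws) s = walk_end ws (i # s)"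
| "walk_end (None # ws) s = walk_end ws (tl s)"

lemma walk_append: "walk (xs @ ys) s = walk xs s \<union> walk ys (walk_end xs s)"
  by (induction xs s rule: walk.induct) auto

text \<open>Locates a moment at which the stack equals \<open>p\<close>, so that a detour from
  \<open>p\<close> can be spliced in there.\<close>

lemma walk_visits:
  "p = s \<or> p \<in> fst ` walk ws s \<Longrightarrow> \<exists>xs ys. ws = xs @ ys \<and> walk_end xs s = p"
proof (induction ws s rule: walk.induct)
  case (1 s)
  then show ?case by auto
next
  case (2 i b ws s)
  show ?case
  proof (cases "p = s")
    case True
    then show ?thesis by (metis append_Nil walk_end.simps(1))
  next
    case False
    then obtain xs ys where "ws = xs @ ys" "walk_end xs (i # s) = p"
      using 2 by auto
    then have "Some (i, b) # ws = (Some (i, b) # xs) @ ys \<and> walk_end (Some (i, b) # xs) s = p"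
      by simp
    then show ?thesis by blast
  qed
next
  case (3 ws s)
  show ?case
  proof (cases "p = s")
    case True
    then show ?thesis by (metis append_Nil walk_end.simps(1))
  next
    case False
    then obtain xs ys where "ws = xs @ ys" "walk_end xs (tl s) = p"
      using 3 by auto
    then have "None # ws = (None # xs) @ ys \<and> walk_end (None # xs) s = p"
      by simp
    then show ?thesis by blast
  qed
qed

text \<open>Induction on the size of \<open>A\<close>. A longest node is a leaf and can be removed;
  a walk for the rest passes through its parent, where pushing and popping the leaf adds it at the
  cost of two tokens.\<close>

lemma ex_walk:
  fixes b :: "nat list \<Rightarrow> bool"
  assumes "finite A" and "[] \<notin> A" and "\<And>i s. i # s \<in> A \<Longrightarrow> s = [] \<or> s \<in> A"
    and "\<And>i s. i # s \<in> A \<Longrightarrow> i < d"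
  shows "\<exists>ws. walk ws [] = (\<lambda>p. (p, b p)) ` A \<and> length ws = 2 * card A
    \<and> (\<forall>i c. Some (i, c) \<in> set ws \<longrightarrow> i < d)"
  using assms
proof (induction "card A" arbitrary: A)
  case 0
  then have "A = {}" by simp
  then show ?case by (intro exI[of _ "[]"]) simp
next
  case (Suc n)
  then have "A \<noteq> {}" by auto
  define l where "l = Max (length ` A)"
  have "l \<in> length ` A"
    unfolding l_def using Suc.prems(1) \<open>A \<noteq> {}\<close> by (intro Max_in) auto
  then obtain p where p: "p \<in> A" "length p = l" by auto
  have longest: "length q \<le> length p" if "q \<in> A" for q
    using that Suc.prems(1) p(2) by (simp add: l_def)
  obtain i s where pis: "p = i # s"
    using p Suc.prems(2) by (cases p) auto
  let ?A = "A - {p}"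
  have "\<exists>ws. walk ws [] = (\<lambda>p. (p, b p)) ` ?A \<and> length ws = 2 * card ?A
    \<and> (\<forall>i c. Some (i, c) \<in> set ws \<longrightarrow> i < d)"
  proof (rule Suc.hyps(1))
    show "n = card ?A" using Suc.hyps(2) Suc.prems(1) p by simp
    show "t = [] \<or> t \<in> ?A" if "j # t \<in> ?A" for j t
      using that Suc.prems(3) longest[of "j # t"] by auto
  qed (use Suc.prems in auto)
  then obtain ws where ws: "walk ws [] = (\<lambda>p. (p, b p)) ` ?A" "length ws = 2 * card ?A"
    "\<And>i c. Some (i, c) \<in> set ws \<Longrightarrow> i < d" by blast
  have "s = [] \<or> s \<in> ?A"
    using Suc.prems(3)[of i s] p pis by auto
  then have "s = [] \<or> s \<in> fst ` walk ws []"
    by (auto simp: ws(1) image_image)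
  from walk_visits[OF this] obtain xs ys where xy: "ws = xs @ ys" "walk_end xs [] = s"
    by blast
  \<comment> \<open>The detour ends on the stack \<open>s\<close> again, so \<open>ys\<close> visits
    the same nodes as before.\<close>
  let ?ws = "xs @ Some (i, b p) # None # ys"
  have "walk ?ws [] = insert (p, b p) (walk ws [])"
    using xy pis by (auto simp: walk_append)
  also have "\<dots> = (\<lambda>p. (p, b p)) ` A"
    using ws(1) p by auto
  finally have "walk ?ws [] = (\<lambda>p. (p, b p)) ` A" .
  moreover have "length ?ws = 2 * card A"
    using ws(2) xy card.remove[OF Suc.prems(1) p(1)] by simp
  moreover have "\<forall>j c. Some (j, c) \<in> set ?ws \<longrightarrow> j < d"
    using ws(3) xy p pis Suc.prems(4) by auto
  ultimately show ?case by blast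
qed

section \<open>Labels and the decoder\<close>

fun token_code :: "token \<Rightarrow> nat" where
  "token_code None = 0"
| "token_code (Some (i, b)) = 2 * i + 1 + of_bool b"

lemma inj_token_code: "inj token_code"
proof
  fix x y assume "token_code x = token_code y"
  then show "x = y"
    by (cases x; cases y) (auto split: if_splits simp: of_bool_def, presburger+)
qed

text \<open>The shift by \<open>Suc\<close> reserves 0 for the separator: the first 0 ends the name,
  although 0 occurs again as the code of a pop.\<close>

definition label_code :: "nat list \<times> token list \<Rightarrow> bool list" where
  "label_code = (\<lambda>(p, ws). word_code (map Suc p @ 0 # map token_code ws))"

lemma map_Suc_separated:
  "map Suc p @ 0 # x = map Suc q @ 0 # y \<Longrightarrow> p = q \<and> x = y"
proof (induction p arbitrary: q)
  case Nil
  then show ?case by (cases q) auto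
next
  case (Cons a p)
  then show ?case by (cases q) auto
qed

lemma inj_label_code: "inj label_code"
proof
  fix x y assume eq: "label_code x = label_code y"
  obtain p ws q vs where xy: "x = (p, ws)" "y = (q, vs)" by (cases x; cases y)
  have "map Suc p @ 0 # map token_code ws = map Suc q @ 0 # map token_code vs"
    using eq inj_word_code by (auto simp: label_code_def xy inj_eq)
  from map_Suc_separated[OF this] show "x = y"
    using inj_token_code by (simp add: xy inj_map_eq_map)
qed

lemma length_label_code:
  assumes "\<And>i. i \<in> set p \<Longrightarrow> i < d" and "\<And>i c. Some (i, c) \<in> set ws \<Longrightarrow> i < d"
    and "d \<le> 2 ^ j"
  shows "length (label_code (p, ws)) \<le> (length p + length ws + 1) * (2 * j + 5)"
proof -
  \<comment> \<open>A push with \<open>i < d\<close> has code at most \<open>2 * i + 2\<close>,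
    hence at most \<open>2 ^ (j + 1)\<close>, and name entries are at most \<open>2 ^ j\<close>; two
    extra binary digits suffice.\<close>
  have "x < 2 ^ (j + 2)" if x: "x \<in> set (map Suc p @ 0 # map token_code ws)" for x
  proof -
    have "token_code w < 2 ^ (j + 2)" if "w \<in> set ws" for w
    proof (cases w)
      case (Some ib)
      obtain i b where "ib = (i, b)" by (cases ib)
      then have "i < d" using assms(2) that Some by auto
      then show ?thesis using assms(3) Some \<open>ib = (i, b)\<close> by (cases b) auto
    qed simp
    moreover have "Suc i < 2 ^ (j + 2)" if "i \<in> set p" for i
      using assms(1)[OF that] assms(3) by simp
    ultimately show ?thesis using x by auto
  qed
  then have "length (word_code (map Suc p @ 0 # map token_code ws))
      \<le> length (map Suc p @ 0 # map token_code ws) * (2 * (j + 2) + 1)"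
    by (rule length_word_code)
  then show ?thesis by (simp add: label_code_def algebra_simps)
qed

text \<open>The first label supplies the tree, the second a name. Dropping \<open>t\<close> entries
  of the name gives the ancestor at level \<open>t\<close>, so \<open>LEAST\<close> finds the lowest
  one in the tree.\<close>

definition label_decoder :: decoder where
  "label_decoder x y =
     (let D = walk (snd (inv label_code x)) []; p = fst (inv label_code y);
          t = (LEAST t. drop t p \<in> fst ` D)
      in (drop t p, True) \<in> D)"

section \<open>Names of the parts of a merge sequence\<close>

definition part_of :: "'a set set \<Rightarrow> 'a \<Rightarrow> 'a set" where
  "part_of P v = (THE X. X \<in> P \<and> v \<in> X)"

lemma part_of_eq:
  assumes "partition_on V P" and "X \<in> P" and "v \<in> X"
  shows "part_of P v = X"
  unfolding part_of_def
  by (rule the_equality) (use assms in \<open>auto simp: partition_on_def disjoint_def\<close>)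

lemma
  assumes "partition_on V P" and "v \<in> V"
  shows part_of_in: "part_of P v \<in> P" and in_part_of: "v \<in> part_of P v"
proof -
  obtain X where "X \<in> P" "v \<in> X" using assms by (auto simp: partition_on_def)
  then show "part_of P v \<in> P" "v \<in> part_of P v"
    using part_of_eq[OF assms(1)] by auto
qed

lemma Ball_R_Suc_0: "Ball_R R (Suc 0) u = {w. w = u \<or> {u, w} \<in> R}"
proof -
  have "(\<exists>d\<le>Suc 0. Q d) \<longleftrightarrow> Q 0 \<or> Q (Suc 0)" for Q :: "nat \<Rightarrow> bool"
    by (metis le0 le_Suc_eq le_zero_eq)
  then show ?thesis unfolding Ball_R_def by auto
qed

locale merged_graph =
  fixes G :: "'a ugraph" and S :: "'a mseq"
  assumes simple: "simple_graph G" and merge: "merge_sequence G S"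
begin

abbreviation "V \<equiv> verts G"
abbreviation "len \<equiv> length S"
abbreviation "P t \<equiv> fst (S ! t)"
abbreviation "R t \<equiv> snd (S ! t)"
abbreviation "part t v \<equiv> part_of (P t) v"
abbreviation "children t Y \<equiv> {X \<in> P t. X \<subseteq> Y}"

lemma finite_V: "finite V"
  using simple by (simp add: simple_graph_def)

lemma len_pos: "0 < len"
  using merge by (simp add: merge_sequence_def)

lemma partition: "t < len \<Longrightarrow> partition_on V (P t)"
  and homogeneous: "t < len \<Longrightarrow> homogeneous_mod G (R t) (P t)"
  using merge nth_mem[of t S] unfolding merge_sequence_def by (fastforce simp: split_beta)+

lemma P_first: "P 0 = (\<lambda>v. {v}) ` V"
  using merge by (auto simp: merge_sequence_def hd_conv_nth)

lemma P_last: "P (len - 1) = {V}"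
  using merge by (auto simp: merge_sequence_def last_conv_nth)

lemma P_refines: "Suc t < len \<Longrightarrow> refines V (P t) (P (Suc t))"
  and R_mono: "Suc t < len \<Longrightarrow> R t \<subseteq> R (Suc t)"
  using merge by (auto simp: merge_sequence_def)

lemma part_in: "t < len \<Longrightarrow> v \<in> V \<Longrightarrow> part t v \<in> P t"
  and in_part: "t < len \<Longrightarrow> v \<in> V \<Longrightarrow> v \<in> part t v"
  using part_of_in in_part_of partition by metis+

lemma part_subset: "t < len \<Longrightarrow> v \<in> V \<Longrightarrow> part t v \<subseteq> V"
  using part_in partition partition_onD1 by (metis Union_upper)

lemma part_eqI: "t < len \<Longrightarrow> v \<in> V \<Longrightarrow> w \<in> part t v \<Longrightarrow> part t w = part t v"
  by (rule part_of_eq[OF partition part_in])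

lemma part_mono:
  assumes "Suc t < len" and "v \<in> V"
  shows "part t v \<subseteq> part (Suc t) v"
proof -
  obtain Y where Y: "Y \<in> P (Suc t)" "part t v \<subseteq> Y"
    using P_refines[OF assms(1)] part_in[of t v] assms by (auto simp: refines_def)
  then have "part (Suc t) v = Y"
    using part_of_eq[OF partition] assms in_part[of t v] by auto
  then show ?thesis using Y by simp
qed

section \<open>Valency and the numbering of children\<close>

lemma finite_P: "t < len \<Longrightarrow> finite (P t)"
  using finite_elements[OF finite_V partition] .

text \<open>A \<open>LEAST\<close> has its property only if some bound exists; the total number of
  parts over all levels is one.\<close>

lemma valency_property:
  "Suc t < len \<Longrightarrow> Y \<in> P (Suc t) \<Longrightarrow> \<exists>F\<subseteq>P t. finite F \<and> card F \<le> valency S \<and> Y = \<Union>F"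
proof -
  let ?Q = "\<lambda>d. \<forall>i. Suc i < len \<longrightarrow> (\<forall>Y\<in>P (Suc i). \<exists>F\<subseteq>P i. finite F \<and> card F \<le> d \<and> Y = \<Union>F)"
  have "?Q (\<Sum>i<len. card (P i))"
  proof (intro allI impI ballI)
    fix i Y assume i: "Suc i < len" and Y: "Y \<in> P (Suc i)"
    have fin: "finite (P i)" using i finite_P by simp
    have "Y \<subseteq> \<Union>(children i Y)"
    proof
      fix y assume y: "y \<in> Y"
      then have yV: "y \<in> V" using Y partition[OF i] by (auto simp: partition_on_def)
      have "part (Suc i) y = Y" using part_of_eq[OF partition[OF i] Y y] .
      then show "y \<in> \<Union>(children i Y)"
        using part_in[of i y] in_part[of i y] part_mono[OF i yV] i yV by auto
    qed
    then have "Y = \<Union>(children i Y)" by auto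
    moreover have "card (children i Y) \<le> card (P i)" by (rule card_mono) (use fin in auto)
    moreover have "card (P i) \<le> (\<Sum>i<len. card (P i))"
      by (rule member_le_sum) (use i in auto)
    ultimately show "\<exists>F\<subseteq>P i. finite F \<and> card F \<le> (\<Sum>i<len. card (P i)) \<and> Y = \<Union>F"
      using fin by (intro exI[of _ "children i Y"]) auto
  qed
  then have "?Q (valency S)"
    unfolding valency_def by (rule LeastI)
  then show "Suc t < len \<Longrightarrow> Y \<in> P (Suc t) \<Longrightarrow> \<exists>F\<subseteq>P t. finite F \<and> card F \<le> valency S \<and> Y = \<Union>F"
    by blast
qed

text \<open>Parts are nonempty and disjoint, so any family of parts with union \<open>Y\<close>
  contains every part inside \<open>Y\<close>.\<close>

lemma card_children:
  assumes "Suc t < len" and "Y \<in> P (Suc t)"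
  shows "card (children t Y) \<le> valency S"
proof -
  obtain F where F: "F \<subseteq> P t" "finite F" "card F \<le> valency S" "Y = \<Union>F"
    using valency_property[OF assms] by blast
  have part: "partition_on V (P t)" using partition assms by simp
  have "children t Y \<subseteq> F"
  proof
    fix X assume X: "X \<in> children t Y"
    then obtain x where "x \<in> X" using partition_onD3[OF part] by fastforce
    moreover then obtain Z where "Z \<in> F" "x \<in> Z" using X F by auto
    ultimately show "X \<in> F"
      using part_of_eq[OF part, of X x] part_of_eq[OF part, of Z x] X F by auto
  qed
  then show ?thesis using F card_mono by (metis le_trans)
qed

text \<open>The choice depends only on the level and the parent, so all vertices of a part receive
  the same index.\<close>

definition child_index :: "nat \<Rightarrow> 'a set \<Rightarrow> 'a set \<Rightarrow> nat" where
  "child_index t Y = (SOME f. inj_on f (children t Y) \<and> f ` children t Y \<subseteq> {..<valency S})"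

lemma child_index:
  assumes "Suc t < len" and "Y \<in> P (Suc t)"
  shows "inj_on (child_index t Y) (children t Y)"
    and "child_index t Y ` children t Y \<subseteq> {..<valency S}"
proof -
  have "finite (children t Y)" using finite_P assms by simp
  then obtain f :: "'a set \<Rightarrow> nat" where "inj_on f (children t Y)" "f ` children t Y \<subseteq> {..<valency S}"
    using card_le_inj[of "children t Y" "{..<valency S}"] card_children[OF assms] by auto
  then have "\<exists>f :: 'a set \<Rightarrow> nat. inj_on f (children t Y) \<and> f ` children t Y \<subseteq> {..<valency S}"
    by blast
  from someI_ex[OF this] show "inj_on (child_index t Y) (children t Y)"
    "child_index t Y ` children t Y \<subseteq> {..<valency S}"
    unfolding child_index_def by auto
qed

definition index :: "nat \<Rightarrow> 'a \<Rightarrow> nat" where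
  "index t v = (if Suc t < len then child_index t (part (Suc t) v) (part t v) else 0)"

text \<open>The single part of the last level contributes the default index 0. Names at levels
  \<open>t < len\<close> are therefore nonempty, and the length of a name determines its
  level.\<close>

definition name :: "nat \<Rightarrow> 'a \<Rightarrow> nat list" where
  "name t v = map (\<lambda>s. index s v) [t..<len]"

lemma part_in_children: "Suc t < len \<Longrightarrow> v \<in> V \<Longrightarrow> part t v \<in> children t (part (Suc t) v)"
  using part_in[of t v] part_mono by auto

text \<open>The maximum with 1 covers the default index 0, as a sequence of length 1 has valency
  0.\<close>

lemma index_less: "v \<in> V \<Longrightarrow> index t v < max 1 (valency S)"
  using child_index(2)[of t "part (Suc t) v"] part_in_children[of t v] part_in[of "Suc t" v]
  by (fastforce simp: index_def)

lemma length_name: "length (name t v) = len - t"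
  by (simp add: name_def)

lemma name_Cons: "t < len \<Longrightarrow> name t v = index t v # name (Suc t) v"
  by (simp add: name_def upt_conv_Cons)

lemma drop_name: "drop t (name 0 v) = name t v"
  by (simp add: name_def drop_map)

text \<open>Descent from the root: equal tails mean equal parents by induction, and the child
  numbering is injective under a common parent.\<close>

lemma name_eq_iff:
  assumes "t < len" and "u \<in> V" and "v \<in> V"
  shows "name t u = name t v \<longleftrightarrow> part t u = part t v"
  using assms(1)
proof (induction "len - Suc t" arbitrary: t)
  case 0
  then have t: "t = len - 1" by simp
  have "part t u = V" "part t v = V"
    using part_in[of t u] part_in[of t v] assms 0 P_last t by auto
  then show ?case using 0 by (simp add: name_Cons index_def) (simp add: name_def)
next
  case (Suc n)
  then have t: "Suc t < len" by simp
  then have IH: "name (Suc t) u = name (Suc t) v \<longleftrightarrow> part (Suc t) u = part (Suc t) v"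
    using Suc by auto
  have "part (Suc t) u = part (Suc t) v" if "part t u = part t v"
    using that part_mono[OF t assms(2)] in_part[of t v] part_eqI[OF t assms(2), of v] t assms by auto
  moreover have "part t u = part t v"
    if "index t u = index t v" "part (Suc t) u = part (Suc t) v"
    using that t inj_onD[OF child_index(1)[OF t part_in[OF t assms(2)]], of "part t u" "part t v"]
      part_in_children[OF t assms(2)] part_in_children[OF t assms(3)]
    by (simp add: index_def)
  ultimately show ?case
    using IH t by (auto simp: name_Cons index_def)
qed

section \<open>The tree of parts near a vertex\<close>

text \<open>At the last level the width says nothing, but there is only one part.\<close>

definition near :: "'a \<Rightarrow> nat \<Rightarrow> 'a \<Rightarrow> bool" where
  "near u t w \<longleftrightarrow> (Suc t < len \<longrightarrow> part t w \<inter> Ball_R (R (Suc t)) 1 u \<noteq> {})"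

definition near_names :: "'a \<Rightarrow> nat list set" where
  "near_names u = {name t w | t w. t < len \<and> w \<in> V \<and> near u t w}"

text \<open>At level 0 the parts are singletons, so nothing has to be excluded by R.\<close>

definition joined :: "'a \<Rightarrow> nat list \<Rightarrow> bool" where
  "joined u p \<longleftrightarrow> (\<exists>t<len. \<exists>w\<in>V. p = name t w \<and> w \<noteq> u \<and> (t = 0 \<or> {u, w} \<notin> R t) \<and> {u, w} \<in> edges G)"

lemma name_in_near_names:
  assumes "t < len" and "v \<in> V"
  shows "name t v \<in> near_names u \<longleftrightarrow> near u t v"
proof
  assume "name t v \<in> near_names u"
  then obtain s w where sw: "name t v = name s w" "s < len" "w \<in> V" "near u s w"
    by (auto simp: near_names_def)
  then have "s = t" using length_name[of t v] length_name[of s w] assms by simp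
  then show "near u t v" using sw assms name_eq_iff[of t v w] by (simp add: near_def)
qed (use assms in \<open>auto simp: near_names_def\<close>)

text \<open>Both the part of \<open>w\<close> and the ball around \<open>u\<close> grow with the
  level, so they still meet; at the last level nothing has to meet.\<close>

lemma near_Suc:
  assumes "Suc t < len" and "w \<in> V" and "near u t w"
  shows "near u (Suc t) w"
proof (cases "Suc (Suc t) < len")
  case True
  then show ?thesis
    using assms part_mono[OF assms(1,2)] R_mono[OF True] by (auto simp: near_def Ball_R_Suc_0)
qed (simp add: near_def)

text \<open>Supplies hypotheses of \<open>ex_walk\<close> for the tree of near parts; closure under
  parents comes from \<open>near_Suc\<close>.\<close>

lemma near_names_closed:
  assumes "i # s \<in> near_names u"
  shows "s = [] \<or> s \<in> near_names u" and "i < max 1 (valency S)"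
proof -
  obtain t w where tw: "i # s = name t w" "t < len" "w \<in> V" "near u t w"
    using assms by (auto simp: near_names_def)
  then have ieq: "i = index t w" "s = name (Suc t) w" by (auto simp: name_Cons)
  then show "i < max 1 (valency S)" using index_less tw by blast
  show "s = [] \<or> s \<in> near_names u"
  proof (cases "Suc t < len")
    case True
    then show ?thesis using ieq tw near_Suc name_in_near_names by auto
  next
    case False
    then show ?thesis using ieq by (simp add: name_def)
  qed
qed

lemma Nil_not_near: "[] \<notin> near_names u"
  by (auto simp: near_names_def name_Cons)

section \<open>The size of the tree\<close>

lemma card_parts_meeting_le:
  assumes "Suc t < len" and "u \<in> V"
  shows "card (parts_meeting (Ball_R (R (Suc t)) 1 u) (P t)) \<le> radius_width 1 G S"
proof -
  let ?f = "\<lambda>i v. card (parts_meeting (Ball_R (R (Suc i)) 1 v) (P i))"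
  have "{?f i v | i v. Suc i < len \<and> v \<in> V} \<subseteq> (\<lambda>(i, v). ?f i v) ` ({..<len} \<times> V)"
    by force
  then have "finite {?f i v | i v. Suc i < len \<and> v \<in> V}"
    by (rule finite_subset) (simp add: finite_V)
  then show ?thesis
    unfolding radius_width_def using assms by (intro Max_ge) auto
qed

text \<open>Summation over the levels: each level below the last contributes at most the width, the
  last one its single part.\<close>

lemma near_names_finite_card:
  assumes "u \<in> V"
  shows "finite (near_names u)" and "card (near_names u) \<le> (len - 1) * radius_width 1 G S + 1"
proof -
  define N where "N t = name t ` {w \<in> V. near u t w}" for t
  have finN: "finite (N t)" for t using finite_V by (simp add: N_def)
  have U: "near_names u = (\<Union>t<len. N t)" by (auto simp: near_names_def N_def)
  then show "finite (near_names u)" using finN by simp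
  have small: "card (N t) \<le> radius_width 1 G S" if t: "Suc t < len" for t
  proof -
    let ?M = "parts_meeting (Ball_R (R (Suc t)) 1 u) (P t)"
    \<comment> \<open>A name depends only on the part, so any representative recovers it; names are
      thus counted by parts that meet the ball.\<close>
    have "N t \<subseteq> (\<lambda>X. name t (SOME x. x \<in> X)) ` ?M"
    proof
      fix p assume "p \<in> N t"
      then obtain w where w: "p = name t w" "w \<in> V" "near u t w" by (auto simp: N_def)
      define x where "x = (SOME x. x \<in> part t w)"
      have x: "x \<in> part t w" unfolding x_def using in_part w t by (metis Suc_lessD someI)
      then have "part t x = part t w" using part_eqI[of t w x] w t by simp
      moreover have "x \<in> V" using x part_subset[of t w] w t by auto
      ultimately have "p = name t x" using name_eq_iff[of t w x] w t by simp
      moreover have "part t w \<in> ?M"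
        using w t part_in by (auto simp: parts_meeting_def near_def)
      ultimately show "p \<in> (\<lambda>X. name t (SOME x. x \<in> X)) ` ?M" unfolding x_def by blast
    qed
    moreover have "finite ?M" using finite_P t by (simp add: parts_meeting_def)
    ultimately have "card (N t) \<le> card ?M" by (rule surj_card_le[rotated])
    then show ?thesis using card_parts_meeting_le[OF t assms] by simp
  qed
  have top: "card (N (len - 1)) \<le> 1"
  proof -
    have "name (len - 1) w = [0]" for w
      using name_Cons[of "len - 1" w] len_pos by (simp add: index_def) (simp add: name_def)
    then have "N (len - 1) \<subseteq> {[0]}" by (auto simp: N_def)
    then show ?thesis using card_mono[of "{[0]}" "N (len - 1)"] by simp
  qed
  have "card (near_names u) \<le> (\<Sum>t<len. card (N t))"
    unfolding U by (rule card_UN_le) simp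
  also have "\<dots> = (\<Sum>t<len - 1. card (N t)) + card (N (len - 1))"
    using len_pos sum.lessThan_Suc[of "\<lambda>t. card (N t)" "len - 1"] by simp
  also have "(\<Sum>t<len - 1. card (N t)) \<le> (\<Sum>t<len - 1. radius_width 1 G S)"
    by (rule sum_mono) (use small in auto)
  finally show "card (near_names u) \<le> (len - 1) * radius_width 1 G S + 1"
    using top by simp
qed

text \<open>If t is the least level at which v's part is near u, then uv is not in R t (unless t = 0),
  so homogeneity makes the adjacency of u and v readable off the two parts at level t.\<close>

lemma edge_iff_joined:
  assumes "u \<in> V" and "v \<in> V" and "u \<noteq> v"
    and "t < len" and "near u t v" and least: "\<And>s. s < t \<Longrightarrow> \<not> near u s v"
  shows "{u, v} \<in> edges G \<longleftrightarrow> joined u (name t v)"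
proof -
  \<comment> \<open>A pair in \<open>R (Suc s)\<close> would put \<open>v\<close> into the ball that
    defines nearness at level \<open>s\<close>, against the minimality of \<open>t\<close>.\<close>
  have notR: "t = 0 \<or> {u, v} \<notin> R t"
  proof (rule ccontr)
    assume "\<not> ?thesis"
    then obtain s where s: "t = Suc s" "{u, v} \<in> R (Suc s)" by (cases t) auto
    have "v \<in> part s v" using in_part[of s v] assms s by simp
    then have "near u s v" using s by (auto simp: near_def Ball_R_Suc_0)
    then show False using least s by simp
  qed
  show ?thesis
  proof
    assume "{u, v} \<in> edges G"
    then show "joined u (name t v)" using assms notR by (auto simp: joined_def)
  next
    assume "joined u (name t v)"
    then obtain s w where sw: "s < len" "w \<in> V" "name t v = name s w" "w \<noteq> u"
      "s = 0 \<or> {u, w} \<notin> R s" "{u, w} \<in> edges G" by (auto simp: joined_def)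
    then have st: "s = t" using length_name[of t v] length_name[of s w] assms by simp
    then have eq: "part t v = part t w" using name_eq_iff[of t v w] sw assms by simp
    show "{u, v} \<in> edges G"
    proof (cases "t = 0")
      case True
      then have "part t v = {v}" using part_in[of t v] in_part[of t v] assms P_first by auto
      then have "v = w" using eq in_part[of t w] sw assms by auto
      then show ?thesis using sw by simp
    next
      case False
      then have "{u, v} \<notin> R t" "{u, w} \<notin> R t" using notR sw st by auto
      moreover have "u \<in> part t u" "v \<in> part t v" "w \<in> part t v" "part t u \<in> P t" "part t v \<in> P t"
        using in_part part_in eq assms sw by auto
      \<comment> \<open>Homogeneity for the parts of \<open>u\<close> and \<open>v\<close>, possibly
        the same part, gives \<open>v\<close> and \<open>w\<close> the same adjacency to
        \<open>u\<close>.\<close>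
      ultimately show ?thesis
        using homogeneous[OF \<open>t < len\<close>] sw(4,6) assms(3)
        unfolding homogeneous_mod_def by metis
    qed
  qed
qed

section \<open>Length and correctness of the labels\<close>

text \<open>A label consists of \<open>len\<close> name entries, one separator and two tokens per
  near part, each costing at most \<open>2 * j + 5\<close> bits.\<close>

lemma ex_labels:
  assumes "max 1 (valency S) \<le> 2 ^ j"
  shows "\<exists>lab. (\<forall>u\<in>V. length (lab u) \<le> (2 * ((len - 1) * radius_width 1 G S + 1) + len + 1) * (2 * j + 5))
    \<and> (\<forall>u\<in>V. \<forall>v\<in>V. u \<noteq> v \<longrightarrow> ({u, v} \<in> edges G \<longleftrightarrow> label_decoder (lab u) (lab v)))"
proof -
  let ?d = "max 1 (valency S)"
  have "\<forall>u\<in>V. \<exists>ws. walk ws [] = (\<lambda>p. (p, joined u p)) ` near_names u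
    \<and> length ws = 2 * card (near_names u) \<and> (\<forall>i c. Some (i, c) \<in> set ws \<longrightarrow> i < ?d)"
    by (intro ballI ex_walk near_names_finite_card(1) Nil_not_near near_names_closed)
  from bchoice[OF this] obtain W where
    "\<forall>u\<in>V. walk (W u) [] = (\<lambda>p. (p, joined u p)) ` near_names u
      \<and> length (W u) = 2 * card (near_names u) \<and> (\<forall>i c. Some (i, c) \<in> set (W u) \<longrightarrow> i < ?d)" ..
  then have W: "\<And>u. u \<in> V \<Longrightarrow> walk (W u) [] = (\<lambda>p. (p, joined u p)) ` near_names u"
    "\<And>u. u \<in> V \<Longrightarrow> length (W u) = 2 * card (near_names u)"
    "\<And>u i c. u \<in> V \<Longrightarrow> Some (i, c) \<in> set (W u) \<Longrightarrow> i < ?d" by blast+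
  define lab where "lab u = label_code (name 0 u, W u)" for u
  have "length (lab u) \<le> (2 * ((len - 1) * radius_width 1 G S + 1) + len + 1) * (2 * j + 5)"
    if u: "u \<in> V" for u
  proof -
    have "i < ?d" if "i \<in> set (name 0 u)" for i
      using that index_less[OF u] by (auto simp: name_def)
    then have "length (lab u) \<le> (length (name 0 u) + length (W u) + 1) * (2 * j + 5)"
      unfolding lab_def using W(3)[OF u] assms by (rule length_label_code)
    also have "\<dots> \<le> (2 * ((len - 1) * radius_width 1 G S + 1) + len + 1) * (2 * j + 5)"
      using near_names_finite_card(2)[OF u] W(2)[OF u]
      by (intro mult_right_mono) (auto simp: length_name)
    finally show ?thesis .
  qed
  moreover have "{u, v} \<in> edges G \<longleftrightarrow> label_decoder (lab u) (lab v)"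
    if uv: "u \<in> V" "v \<in> V" "u \<noteq> v" for u v
  proof -
    define t where "t = (LEAST t. name t v \<in> near_names u)"
    \<comment> \<open>The last level is near every vertex, so a least level exists.\<close>
    have "name (len - 1) v \<in> near_names u"
      using name_in_near_names[of "len - 1" v u] len_pos uv by (simp add: near_def)
    then have t: "name t v \<in> near_names u" "t \<le> len - 1"
      unfolding t_def by (rule LeastI, rule Least_le)
    then have tl: "t < len" using len_pos by linarith
    have "\<not> near u s v" if "s < t" for s
      using not_less_Least[of s "\<lambda>t. name t v \<in> near_names u"] that tl uv name_in_near_names[of s v u]
      by (auto simp: t_def)
    moreover have "near u t v" using t tl uv name_in_near_names by simp
    ultimately have "{u, v} \<in> edges G \<longleftrightarrow> joined u (name t v)"
      using edge_iff_joined uv tl by blast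
    \<comment> \<open>As \<open>drop s (name 0 v)\<close> is \<open>name s v\<close>, the decoder
      finds the same \<open>t\<close>, and the bit stored there is
      \<open>joined u (name t v)\<close>.\<close>
    also have "\<dots> \<longleftrightarrow> label_decoder (lab u) (lab v)"
      using t(1) by (auto simp: label_decoder_def lab_def inv_f_f[OF inj_label_code] drop_name
          W(1)[OF uv(1)] image_image t_def[symmetric])
    finally show ?thesis .
  qed
  ultimately show ?thesis by blast
qed

section \<open>Absorbing the additive terms\<close>

text \<open>These bounds make every factor of the product in the length bound at least 1, so that it
  dominates the additive terms.\<close>

lemma parameters_nontrivial:
  assumes "card V \<ge> 2"
  shows "len \<ge> 2" and "valency S \<ge> 2" and "radius_width 1 G S \<ge> 1"
proof -
  have "\<exists>u\<in>V. \<exists>v\<in>V. u \<noteq> v"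
    using assms card_le_Suc0_iff_eq[OF finite_V] by auto
  then obtain u v where uv: "u \<in> V" "v \<in> V" "u \<noteq> v" by blast
  have part0: "part 0 w = {w}" if "w \<in> V" for w
    using part_in[of 0 w] in_part[of 0 w] that len_pos P_first by auto
  show len2: "len \<ge> 2"
  proof (rule ccontr)
    assume "\<not> ?thesis"
    then have "len - 1 = 0" by simp
    then have "part 0 u = V" using P_last part_in[of 0 u] len_pos uv by auto
    then show False using part0[OF uv(1)] uv by (metis singletonD)
  qed
  \<comment> \<open>With valency at most 1 every index is 0, so two vertices would share a name at
    level 0, where parts are singletons.\<close>
  show "valency S \<ge> 2"
  proof (rule ccontr)
    assume "\<not> ?thesis"
    then have "index t w = 0" if "w \<in> V" for t w
      using index_less[OF that, of t] by auto
    then have "name 0 u = name 0 v" using uv by (simp add: name_def)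
    then show False using name_eq_iff[of 0 u v] len_pos uv part0 by auto
  qed
  let ?M = "parts_meeting (Ball_R (R (Suc 0)) 1 u) (P 0)"
  have "part 0 u \<in> ?M"
    using part_in[of 0 u] part0[OF uv(1)] uv len_pos by (auto simp: parts_meeting_def Ball_R_Suc_0)
  moreover have "finite ?M" using finite_P len_pos by (simp add: parts_meeting_def)
  ultimately have "card ?M \<ge> 1" by (metis One_nat_def Suc_leI card_gt_0_iff empty_iff)
  then show "radius_width 1 G S \<ge> 1"
    using card_parts_meeting_le[of 0 u] len2 uv by simp
qed

end

text \<open>The constant is 4 * 9. The first factor is 2(m - 1)k + m + 3 \<le> 4mk; with L =
  \<open>log 2 d\<close> \<ge> 1 and j < L + 1, the second is at most 2L + 7 \<le> 9L.\<close>

lemma label_bound_le: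
  fixes m k d j :: nat
  assumes "m \<ge> 2" and "k \<ge> 1" and "d \<ge> 2" and "j = nat \<lceil>log 2 (real d)\<rceil>"
  shows "real ((2 * ((m - 1) * k + 1) + m + 1) * (2 * j + 5)) \<le> 36 * (real m * real k * log 2 (real d))"
proof -
  have "log 2 (real d) \<ge> 1" using assms(3) by (simp add: le_log_iff)
  then have j: "real (2 * j + 5) \<le> 9 * log 2 (real d)"
    using assms(4) by linarith
  have "m \<le> m * k" using assms(2) by simp
  moreover have "m * k = (m - 1) * k + k" using assms(1) by (cases m) auto
  ultimately have "2 * ((m - 1) * k + 1) + m + 1 \<le> 4 * (m * k)"
    using assms(1,2) by presburger
  then have "real (2 * ((m - 1) * k + 1) + m + 1) \<le> real (4 * (m * k))"
    by (rule of_nat_mono)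
  then have "real (2 * ((m - 1) * k + 1) + m + 1) * real (2 * j + 5)
      \<le> real (4 * (m * k)) * (9 * log 2 (real d))"
    using j by (rule mult_mono) auto
  then show ?thesis by (simp only: of_nat_mult[symmetric])
qed

theorem theorem8p9:
  fixes C :: "'a ugraph set" and m \<Delta> k :: "nat \<Rightarrow> nat"
  assumes "\<forall>G\<in>C. simple_graph G"
    and "\<forall>n. \<forall>G\<in>C. card (verts G) = n \<longrightarrow>
           (\<exists>S. merge_sequence G S \<and> length S \<le> m n \<and> valency S \<le> \<Delta> n \<and> radius_width 1 G S \<le> k n)"
  shows "\<exists>(enc :: 'a encoder) (dec :: decoder) (l :: nat \<Rightarrow> nat).
           labelling_scheme C enc dec \<and> has_scheme_length C enc l \<and>
           (\<lambda>n. real (l n)) \<in> O(\<lambda>n. real (m n) * real (k n) * log 2 (real (\<Delta> n)))"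
proof -
  define j where "j n = nat \<lceil>log 2 (real (\<Delta> n))\<rceil>" for n
  define B where "B n = (2 * ((m n - 1) * k n + 1) + m n + 1) * (2 * j n + 5)" for n
  have \<Delta>_le: "max 1 (\<Delta> n) \<le> 2 ^ j n" for n
  proof (cases "\<Delta> n = 0")
    case False
    then have "real (\<Delta> n) = 2 powr log 2 (real (\<Delta> n))" by simp
    also have "\<dots> \<le> 2 powr real (j n)"
      unfolding j_def by (intro powr_mono) linarith+
    also have "\<dots> = real (2 ^ j n)" by (simp add: powr_realpow)
    finally show ?thesis by simp
  qed simp
  \<comment> \<open>Each graph uses its own merge sequence, yet the bound depends only on its order
    and the decoder is common to all graphs.\<close>
  have "\<exists>lab. (\<forall>u\<in>verts G. length (lab u) \<le> B (card (verts G)))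
    \<and> (\<forall>u\<in>verts G. \<forall>v\<in>verts G. u \<noteq> v \<longrightarrow> ({u, v} \<in> edges G \<longleftrightarrow> label_decoder (lab u) (lab v)))"
    if G: "G \<in> C" for G
  proof -
    let ?n = "card (verts G)"
    obtain S where S: "merge_sequence G S" "length S \<le> m ?n" "valency S \<le> \<Delta> ?n"
      "radius_width 1 G S \<le> k ?n" using assms(2) G by blast
    interpret merged_graph G S using assms(1) G S(1) by unfold_locales auto
    have "max 1 (valency S) \<le> 2 ^ j ?n" using S(3) \<Delta>_le[of ?n] by simp
    from ex_labels[OF this] obtain lab where lab:
      "\<forall>u\<in>verts G. length (lab u) \<le>
        (2 * ((length S - 1) * radius_width 1 G S + 1) + length S + 1) * (2 * j ?n + 5)"
      "\<forall>u\<in>verts G. \<forall>v\<in>verts G. u \<noteq> v \<longrightarrow> ({u, v} \<in> edges G \<longleftrightarrow> label_decoder (lab u) (lab v))"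
      by blast
    have "(2 * ((length S - 1) * radius_width 1 G S + 1) + length S + 1) * (2 * j ?n + 5) \<le> B ?n"
      unfolding B_def using S by (intro mult_right_mono add_mono mult_mono) auto
    then show ?thesis using lab by (meson le_trans)
  qed
  then obtain enc where len_enc: "\<And>G u. G \<in> C \<Longrightarrow> u \<in> verts G \<Longrightarrow> length (enc G u) \<le> B (card (verts G))"
    and dec: "\<And>G u v. G \<in> C \<Longrightarrow> u \<in> verts G \<Longrightarrow> v \<in> verts G \<Longrightarrow> u \<noteq> v \<Longrightarrow>
      {u, v} \<in> edges G \<longleftrightarrow> label_decoder (enc G u) (enc G v)"
    by metis
  define l where "l n = Max (insert 0 (label_lengths C enc n))" for n
  have bounded: "label_lengths C enc n \<subseteq> {..B n}" for n
    using len_enc by (auto simp: label_lengths_def)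
  then have fin: "finite (label_lengths C enc n)" for n
    by (rule finite_subset) simp
  have "labelling_scheme C enc label_decoder"
    using dec by (simp add: labelling_scheme_def)
  moreover have "has_scheme_length C enc l"
    using fin by (simp add: has_scheme_length_def l_def)
  moreover have "(\<lambda>n. real (l n)) \<in> O(\<lambda>n. real (m n) * real (k n) * log 2 (real (\<Delta> n)))"
  proof (rule bigoI[where c = 36])
    \<comment> \<open>A one-vertex graph admits a sequence of length 1 and width 0, so the product
      may vanish at \<open>n = 1\<close>; the estimate starts at 2.\<close>
    have "norm (real (l n)) \<le> 36 * norm (real (m n) * real (k n) * log 2 (real (\<Delta> n)))"
      if n: "n \<ge> 2" for n
    proof (cases "label_lengths C enc n = {}")
      \<comment> \<open>With no graph on \<open>n\<close> vertices the hypotheses say nothing about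
        the parameters at \<open>n\<close>, but \<open>l n\<close> is 0.\<close>
      case True
      then show ?thesis by (simp add: l_def)
    next
      case False
      then obtain G where G: "G \<in> C" "card (verts G) = n" by (auto simp: label_lengths_def)
      then obtain S where S: "merge_sequence G S" "length S \<le> m n" "valency S \<le> \<Delta> n"
        "radius_width 1 G S \<le> k n" using assms(2) by blast
      interpret merged_graph G S using assms(1) G S(1) by unfold_locales auto
      have "2 \<le> card (verts G)" using G n by simp
      from parameters_nontrivial[OF this] have "m n \<ge> 2" "k n \<ge> 1" "\<Delta> n \<ge> 2"
        using S by linarith+
      then have "real (B n) \<le> 36 * (real (m n) * real (k n) * log 2 (real (\<Delta> n)))"
        unfolding B_def by (rule label_bound_le) (rule j_def)
      moreover have "l n \<le> B n" using bounded fin by (auto simp: l_def)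
      ultimately have "real (l n) \<le> 36 * (real (m n) * real (k n) * log 2 (real (\<Delta> n)))"
        by linarith
      also have "\<dots> \<le> 36 * norm (real (m n) * real (k n) * log 2 (real (\<Delta> n)))"
        by simp
      finally show ?thesis by simp
    qed
    then show "\<forall>\<^sub>F n in sequentially. norm (real (l n))
        \<le> 36 * norm (real (m n) * real (k n) * log 2 (real (\<Delta> n)))"
      using eventually_sequentially by blast
  qed
  ultimately show ?thesis by blast
qed

end
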